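(* Let $G$ be a $(d,s)$-edge colorable graph of order $n$, and let $h$ be a standard coloring of $G$. If $s\ge 11$ and for some real constant $c$ we have $$\frac12\left(2^{-11}s^{2-c}d^{-1}\right)^{2^{-9}d^{-1}s^2}\ge n,$$ then any $s^{c-1}$-sparse list assignment $L$ for $G$ (with respect to $h$) is avoidable.
   Context: Graphs are finite and simple; the order of a graph is its number of vertices. A cycle in an edge-colored graph is $2$-colored if its edges are properly colored by two distinct colors (so a $4$-cycle is $2$-colored if its edges alternate between two distinct colors). For integers $d,s$, a $d$-regular graph $G$ is $(d,s)$-edge colorable if it admits a proper $d$-edge coloring $h$ in which every edge of $G$ is contained in at least $s-1$ $2$-colored $4$-cycles (necessarily $s\le d$). Such a coloring $h$ is called a standard coloring; it is fixed and uses the colors $\{1,\dots,d\}$. A standard matching of $G$ is a maximum set of edges all having the same color under $h$, i.e. a color class of $h$. The distance between two edges $e,e'$ is the number of edges in a shortest path between an endpoint of $e$ and an endpoint of $e'$. The $t$-neighborhood of an edge $e$ is the graph induced by all edges at distance at most $t$ from $e$. A list assignment $L$ for $G$ (assigning to each edge $e$ a possibly empty set $L(e)\subseteq\{1,\dots,d\}$ of forbidden colors) is $\beta$-sparse if (i) $|L(e)|\le \beta s$ for each edge $e$; (ii) for every vertex $v$, each color in $\{1,\dots,d\}$ occurs in at most $\beta s$ lists of edges incident to $v$; (iii) for every $6$-neighborhood $W$ (of any edge) and every standard matching $M$, any color appears at most $\beta s$ times in lists of edges of $M$ contained in $W$. $L$ is avoidable if there is a proper $d$-edge coloring $\varphi$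 of $G$ with colors $\{1,\dots,d\}$ such that $\varphi(e)\notin L(e)$ for every edge $e$. *)

theory Defs
  imports Complex_Main "HOL-Library.Extended_Nat"
begin

definition simple_graph :: "'v set \<Rightarrow> 'v set set \<Rightarrow> bool" where
  "simple_graph V E \<longleftrightarrow> finite V \<and> (\<forall>e\<in>E. e \<subseteq> V \<and> card e = 2)"

definition regular :: "'v set \<Rightarrow> 'v set set \<Rightarrow> nat \<Rightarrow> bool" where
  "regular V E d \<longleftrightarrow> (\<forall>v\<in>V. card {e \<in> E. v \<in> e} = d)"

definition properly_colored :: "'v set set \<Rightarrow> ('v set \<Rightarrow> nat) \<Rightarrow> bool" where
  "properly_colored F h \<longleftrightarrow> (\<forall>e\<in>F. \<forall>f\<in>F. e \<noteq> f \<and> e \<inter> f \<noteq> {} \<longrightarrow> h e \<noteq> h f)"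

definition proper_edge_coloring :: "'v set set \<Rightarrow> nat \<Rightarrow> ('v set \<Rightarrow> nat) \<Rightarrow> bool" where
  "proper_edge_coloring E d h \<longleftrightarrow> (\<forall>e\<in>E. h e \<in> {1..d}) \<and> properly_colored E h"

text \<open>Cycles are subgraphs, represented by their edge sets, so that a cycle is counted once
  and not once for each way of traversing it.\<close>

definition four_cycle :: "'v set set \<Rightarrow> 'v set set \<Rightarrow> bool" where
  "four_cycle E C \<longleftrightarrow> C \<subseteq> E \<and>
     (\<exists>u v w x. distinct [u, v, w, x] \<and> C = {{u, v}, {v, w}, {w, x}, {x, u}})"

definition two_colored :: "('v set \<Rightarrow> nat) \<Rightarrow> 'v set set \<Rightarrow> bool" where
  "two_colored h C \<longleftrightarrow> properly_colored C h \<and> card (h ` C) = 2"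

definition standard_coloring :: "'v set set \<Rightarrow> nat \<Rightarrow> nat \<Rightarrow> ('v set \<Rightarrow> nat) \<Rightarrow> bool" where
  "standard_coloring E d s h \<longleftrightarrow> proper_edge_coloring E d h \<and>
     (\<forall>e\<in>E. s - 1 \<le> card {C. four_cycle E C \<and> e \<in> C \<and> two_colored h C})"

definition ds_edge_colorable :: "'v set \<Rightarrow> 'v set set \<Rightarrow> nat \<Rightarrow> nat \<Rightarrow> bool" where
  "ds_edge_colorable V E d s \<longleftrightarrow>
     simple_graph V E \<and> regular V E d \<and> (\<exists>h. standard_coloring E d s h)"

definition standard_matching :: "'v set set \<Rightarrow> nat \<Rightarrow> ('v set \<Rightarrow> nat) \<Rightarrow> 'v set set \<Rightarrow> bool" where
  "standard_matching E d h M \<longleftrightarrow> (\<exists>i\<in>{1..d}. M = {e \<in> E. h e = i})"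

definition path :: "'v set \<Rightarrow> 'v set set \<Rightarrow> 'v list \<Rightarrow> bool" where
  "path V E p \<longleftrightarrow> p \<noteq> [] \<and> set p \<subseteq> V \<and> distinct p \<and> successively (\<lambda>u v. {u, v} \<in> E) p"

text \<open>A path given by its list of vertices has one edge less than it has vertices.
  Edges in different components have distance \<open>\<infinity>\<close>, the infimum of the empty set.\<close>

definition edge_dist :: "'v set \<Rightarrow> 'v set set \<Rightarrow> 'v set \<Rightarrow> 'v set \<Rightarrow> enat" where
  "edge_dist V E e e' =
     Inf {enat (length p - 1) | p. path V E p \<and> hd p \<in> e \<and> last p \<in> e'}"

text \<open>The graph induced by a set of edges has exactly these edges (and their endpoints as
  vertices), so a neighborhood is represented by its edge set.\<close>

definition neighborhood :: "'v set \<Rightarrow> 'v set set \<Rightarrow> nat \<Rightarrow> 'v set \<Rightarrow> 'v set set" where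
  "neighborhood V E t e = {e' \<in> E. edge_dist V E e e' \<le> enat t}"

definition list_assignment :: "'v set set \<Rightarrow> nat \<Rightarrow> ('v set \<Rightarrow> nat set) \<Rightarrow> bool" where
  "list_assignment E d L \<longleftrightarrow> (\<forall>e\<in>E. L e \<subseteq> {1..d})"

definition sparse ::
  "'v set \<Rightarrow> 'v set set \<Rightarrow> nat \<Rightarrow> nat \<Rightarrow> ('v set \<Rightarrow> nat) \<Rightarrow> real \<Rightarrow> ('v set \<Rightarrow> nat set) \<Rightarrow> bool" where
  "sparse V E d s h \<beta> L \<longleftrightarrow>
     (\<forall>e\<in>E. real (card (L e)) \<le> \<beta> * real s) \<and>
     (\<forall>v\<in>V. \<forall>i\<in>{1..d}. real (card {e \<in> E. v \<in> e \<and> i \<in> L e}) \<le> \<beta> * real s) \<and>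
     (\<forall>f\<in>E. \<forall>M. standard_matching E d h M \<longrightarrow>
        (\<forall>i\<in>{1..d}. real (card {e \<in> M \<inter> neighborhood V E 6 f. i \<in> L e}) \<le> \<beta> * real s))"

definition avoidable :: "'v set set \<Rightarrow> nat \<Rightarrow> ('v set \<Rightarrow> nat set) \<Rightarrow> bool" where
  "avoidable E d L \<longleftrightarrow> (\<exists>\<phi>. proper_edge_coloring E d \<phi> \<and> (\<forall>e\<in>E. \<phi> e \<notin> L e))"

end

theory Submission
  imports
    Defs
    "HOL-Combinatorics.Permutations"
    "HOL-Library.Disjoint_Sets"
    "HOL-Library.FuncSet"
begin

text \<open>Permute the colors of \<open>h\<close> by some \<open>\<rho>\<close>, chosen by a union bound over all permutations so that
  every vertex meets few conflict edges (edges whose new color is forbidden), and so that for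
  every edge \<open>e\<close> the color \<open>\<rho> j\<close> is forbidden on the edge opposite to \<open>e\<close> in its 2-colored 4-cycle
  with second color \<open>j\<close> for few \<open>j\<close> only. All other obstructions are controlled by sparsity, for every
  \<open>\<rho>\<close>: the condition on a color class in a 6-neighborhood bounds the conflict edges of each color
  there by \<open>s powr c\<close>. Each conflict edge is then repaired by interchanging the two colors on a
  2-colored 4-cycle through it. The cycles are chosen greedily and edge-disjoint, so that the
  interchanges do not interfere; to keep free cycles available, a choice is refused if it would send
  too many cycles through one vertex or use one color too often in a small region. The hypothesis on
  \<open>n\<close> makes the union bound work and also forces \<open>2048 * d * s powr c < s^2\<close>, which leaves room for the
  greedy choice. If \<open>s powr c < 1\<close>, all lists are empty.\<close>

section \<open>Permutations avoiding prescribed values\<close>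

text \<open>There are at most \<open>m\<close> choices for \<open>f j\<close>, and the rest of
  \<open>f\<close> injects \<open>S - {j}\<close> into \<open>S' - {f j}\<close>. Domain and
  codomain are kept apart because the induction removes different points from them.\<close>

lemma card_injections_hitting:
  assumes "finite K" "finite S" "finite S'" "card S = card S'" "K \<subseteq> S"
    and "\<And>j. j \<in> K \<Longrightarrow> finite (F j) \<and> card (F j) \<le> m"
  shows "card {f \<in> S \<rightarrow>\<^sub>E S'. inj_on f S \<and> (\<forall>j\<in>K. f j \<in> F j)} \<le> m ^ card K * fact (card S - card K)"
  using assms
proof (induction K arbitrary: S S' rule: finite_induct)
  case empty
  have "card {f \<in> S \<rightarrow>\<^sub>E S'. inj_on f S} = fact (card S)"
    using card_inj_on_subset_funcset[of S S' S] empty.prems by (simp add: fact_prod_rev)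
  then show ?case by simp
next
  case (insert j K)
  let ?A = "{f \<in> S \<rightarrow>\<^sub>E S'. inj_on f S \<and> (\<forall>i\<in>insert j K. f i \<in> F i)}"
  let ?B = "\<lambda>y. {f \<in> (S - {j}) \<rightarrow>\<^sub>E (S' - {y}). inj_on f (S - {j}) \<and> (\<forall>i\<in>K. f i \<in> F i)}"
  let ?r = "\<lambda>f. (f j, restrict f (S - {j}))"
  have jS: "j \<in> S" using insert.prems by simp
  have fin: "finite (F j \<inter> S')" using insert.prems by simp
  have B: "card (?B y) \<le> m ^ card K * fact (card S - 1 - card K)" if "y \<in> F j \<inter> S'" for y
  proof -
    have "K \<subseteq> S - {j}" using insert.prems(4) insert.hyps(2) by blast
    then show ?thesis
      using insert.IH[of "S - {j}" "S' - {y}"] insert.prems that jS by simp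
  qed
  have finB: "finite (?B y)" for y
    by (rule finite_subset[of _ "(S - {j}) \<rightarrow>\<^sub>E (S' - {y})"])
      (use insert.prems in \<open>auto intro!: finite_PiE\<close>)
  have inj: "inj_on ?r ?A"
  proof (rule inj_onI)
    fix f g assume f: "f \<in> ?A" and g: "g \<in> ?A" and eq: "?r f = ?r g"
    from eq have "f j = g j" and "restrict f (S - {j}) = restrict g (S - {j})" by simp_all
    then have "f i = g i" if "i \<in> S" for i
      using that by (metis DiffI restrict_apply' singletonD)
    then show "f = g" using f g by (intro PiE_ext[of f S "\<lambda>_. S'" g]) auto
  qed
  have img: "?r ` ?A \<subseteq> Sigma (F j \<inter> S') ?B"
  proof
    fix z assume "z \<in> ?r ` ?A"
    then obtain f where f: "f \<in> ?A" and z: "z = ?r f" by blast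
    have "f i \<noteq> f j" if "i \<in> S - {j}" for i
      using f that jS by (auto dest: inj_onD)
    then have "restrict f (S - {j}) \<in> (S - {j}) \<rightarrow>\<^sub>E (S' - {f j})"
      using f by auto
    moreover have "inj_on f (S - {j})"
      using f by (auto intro: inj_on_subset)
    moreover have "\<forall>i\<in>K. restrict f (S - {j}) i \<in> F i"
      using f insert.hyps(2) insert.prems(4) by auto
    ultimately show "z \<in> Sigma (F j \<inter> S') ?B"
      unfolding z using f jS by auto
  qed
  have "card ?A \<le> card (Sigma (F j \<inter> S') ?B)"
    by (rule card_inj_on_le[OF inj img]) (use fin finB in auto)
  also have "\<dots> = (\<Sum>y\<in>F j \<inter> S'. card (?B y))"
    using fin finB by (simp add: card_SigmaI)
  also have "\<dots> \<le> card (F j \<inter> S') * (m ^ card K * fact (card S - 1 - card K))"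
    using sum_bounded_above[of "F j \<inter> S'" "\<lambda>y. card (?B y)"] B by simp
  also have "\<dots> \<le> m * (m ^ card K * fact (card S - 1 - card K))"
    using insert.prems(5)[of j] card_mono[of "F j" "F j \<inter> S'"] by (intro mult_right_mono) auto
  also have "\<dots> = m ^ card (insert j K) * fact (card S - card (insert j K))"
    using insert.hyps by simp
  finally show ?case .
qed

text \<open>A permutation with at least \<open>k\<close> hits has a hit at every point of some
  \<open>k\<close>-subset of \<open>S\<close>, and \<open>(card S choose k) * fact (card S - k) *
  fact k = fact (card S)\<close>. The factor \<open>fact k\<close> on the left avoids a
  division.\<close>

lemma card_permutations_hitting:
  assumes "finite S" "\<And>j. j \<in> S \<Longrightarrow> finite (F j) \<and> card (F j) \<le> m"
  shows "card {\<rho>. \<rho> permutes S \<and> k \<le> card {j \<in> S. \<rho> j \<in> F j}} * fact k \<le> m ^ k * fact (card S)"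
proof (cases "k \<le> card S")
  case True
  let ?P = "\<lambda>K. {\<rho>. \<rho> permutes S \<and> (\<forall>j\<in>K. \<rho> j \<in> F j)}"
  let ?Ks = "{K. K \<subseteq> S \<and> card K = k}"
  have P: "card (?P K) \<le> m ^ k * fact (card S - k)" if "K \<in> ?Ks" for K
  proof -
    have K: "K \<subseteq> S" "card K = k" "finite K"
      using that assms(1) finite_subset by auto
    \<comment> \<open>Restricting to \<open>S\<close> loses nothing, as a permutation of
      \<open>S\<close> is the identity outside.\<close>
    have "card (?P K) \<le> card {f \<in> S \<rightarrow>\<^sub>E S. inj_on f S \<and> (\<forall>j\<in>K. f j \<in> F j)}"
    proof (rule card_inj_on_le[of "\<lambda>\<rho>. restrict \<rho> S"])
      show "inj_on (\<lambda>\<rho>. restrict \<rho> S) (?P K)"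
      proof (rule inj_onI)
        fix \<rho> \<sigma> assume a: "\<rho> \<in> ?P K" "\<sigma> \<in> ?P K" "restrict \<rho> S = restrict \<sigma> S"
        have "\<rho> i = \<sigma> i" for i
          using fun_cong[OF a(3), of i] a(1,2) by (cases "i \<in> S") (auto simp: permutes_def)
        then show "\<rho> = \<sigma>" by blast
      qed
      show "(\<lambda>\<rho>. restrict \<rho> S) ` ?P K \<subseteq> {f \<in> S \<rightarrow>\<^sub>E S. inj_on f S \<and> (\<forall>j\<in>K. f j \<in> F j)}"
      proof (rule image_subsetI)
        fix \<rho> assume r: "\<rho> \<in> ?P K"
        then have "\<rho> i \<in> S \<longleftrightarrow> i \<in> S" "inj_on \<rho> S" for i
          using permutes_in_image[of \<rho> S i] permutes_inj_on[of \<rho> S S] by simp_all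
        then show "restrict \<rho> S \<in> {f \<in> S \<rightarrow>\<^sub>E S. inj_on f S \<and> (\<forall>j\<in>K. f j \<in> F j)}"
          using r K(1) by auto
      qed
      show "finite {f \<in> S \<rightarrow>\<^sub>E S. inj_on f S \<and> (\<forall>j\<in>K. f j \<in> F j)}"
        by (rule finite_subset[of _ "S \<rightarrow>\<^sub>E S"]) (use assms(1) in \<open>auto intro!: finite_PiE\<close>)
    qed
    also have "\<dots> \<le> m ^ k * fact (card S - k)"
      using card_injections_hitting[OF K(3) assms(1) assms(1) refl K(1), of F m] assms(2) K by auto
    finally show ?thesis .
  qed
  have fin: "finite ?Ks" using assms(1) by simp
  have "{\<rho>. \<rho> permutes S \<and> k \<le> card {j \<in> S. \<rho> j \<in> F j}} \<subseteq> (\<Union>K\<in>?Ks. ?P K)"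
  proof
    fix \<rho> assume "\<rho> \<in> {\<rho>. \<rho> permutes S \<and> k \<le> card {j \<in> S. \<rho> j \<in> F j}}"
    then obtain K where "K \<subseteq> {j \<in> S. \<rho> j \<in> F j}" "card K = k" "\<rho> permutes S"
      using obtain_subset_with_card_n by (metis (no_types, lifting) mem_Collect_eq)
    then show "\<rho> \<in> (\<Union>K\<in>?Ks. ?P K)" by (intro UN_I[of K]) auto
  qed
  moreover have "finite (\<Union>K\<in>?Ks. ?P K)"
    by (rule finite_subset[of _ "{\<rho>. \<rho> permutes S}"]) (use finite_permutations[OF assms(1)] in auto)
  ultimately have "card {\<rho>. \<rho> permutes S \<and> k \<le> card {j \<in> S. \<rho> j \<in> F j}} \<le> card (\<Union>K\<in>?Ks. ?P K)"
    by (intro card_mono)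
  also have "\<dots> \<le> (\<Sum>K\<in>?Ks. card (?P K))"
    by (rule card_UN_le[OF fin])
  also have "\<dots> \<le> card ?Ks * (m ^ k * fact (card S - k))"
    using sum_bounded_above[of ?Ks "\<lambda>K. card (?P K)" "m ^ k * fact (card S - k)"] P by simp
  also have "\<dots> = (card S choose k) * (m ^ k * fact (card S - k))"
    using n_subsets[OF assms(1)] by simp
  finally have "card {\<rho>. \<rho> permutes S \<and> k \<le> card {j \<in> S. \<rho> j \<in> F j}} * fact k
      \<le> (card S choose k) * (m ^ k * fact (card S - k)) * fact k"
    by (rule mult_right_mono) simp
  also have "\<dots> = m ^ k * (fact k * fact (card S - k) * (card S choose k))"
    by (simp only: mult_ac)
  finally show ?thesis
    unfolding binomial_fact_lemma[OF True] .
next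
  case False
  have none: "card {j \<in> S. \<rho> j \<in> F j} < k" for \<rho>
    using card_mono[OF assms(1), of "{j \<in> S. \<rho> j \<in> F j}"] False by auto
  have "{\<rho>. \<rho> permutes S \<and> k \<le> card {j \<in> S. \<rho> j \<in> F j}} = {}"
    using none leD by blast
  then show ?thesis by (simp only: card.empty mult_zero_left zero_le)
qed

text \<open>Union bound: each \<open>i\<close> spoils at most the fraction
  \<open>m ^ k / fact k\<close> of all permutations.\<close>

lemma exists_permutation_few_hits:
  assumes "finite S" "finite I"
    and "\<And>i j. i \<in> I \<Longrightarrow> j \<in> S \<Longrightarrow> finite (F i j) \<and> card (F i j) \<le> m"
    and "card I * m ^ k < fact k"
  shows "\<exists>\<rho>. \<rho> permutes S \<and> (\<forall>i\<in>I. card {j \<in> S. \<rho> j \<in> F i j} < k)"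
proof (rule ccontr)
  assume none: "\<not> ?thesis"
  let ?P = "\<lambda>i. {\<rho>. \<rho> permutes S \<and> k \<le> card {j \<in> S. \<rho> j \<in> F i j}}"
  have "{\<rho>. \<rho> permutes S} \<subseteq> (\<Union>i\<in>I. ?P i)"
    using none by (auto simp: not_less)
  moreover have "finite (\<Union>i\<in>I. ?P i)"
    by (rule finite_subset[of _ "{\<rho>. \<rho> permutes S}"]) (use finite_permutations[OF assms(1)] in auto)
  ultimately have "card {\<rho>. \<rho> permutes S} \<le> card (\<Union>i\<in>I. ?P i)"
    by (intro card_mono)
  also have "\<dots> \<le> (\<Sum>i\<in>I. card (?P i))"
    by (rule card_UN_le[OF assms(2)])
  finally have "fact (card S) * fact k \<le> (\<Sum>i\<in>I. card (?P i)) * fact k"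
    using card_permutations[OF refl assms(1)] by simp
  also have "\<dots> = (\<Sum>i\<in>I. card (?P i) * fact k)"
    by (rule sum_distrib_right)
  also have "\<dots> \<le> card I * (m ^ k * fact (card S))"
    using sum_bounded_above[of I "\<lambda>i. card (?P i) * fact k" "m ^ k * fact (card S)"]
      card_permutations_hitting[OF assms(1), of "F _" m k] assms(3)
    by simp
  also have "\<dots> = fact (card S) * (card I * m ^ k)"
    by (simp only: mult_ac)
  finally show False
    using assms(4) by simp
qed

text \<open>\<open>k ^ k / fact k\<close> is one term of the exponential series at \<open>k\<close>,
  hence at most \<open>exp k\<close>, which is at most \<open>3 ^ k\<close>.\<close>

lemma power_self_le_fact: "(real k / 3) ^ k \<le> fact k"
proof -
  have "real k ^ k /\<^sub>R fact k \<le> exp (real k)"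
    using sum_le_suminf[OF summable_exp_generic[of "real k"], of "{k}"]
    by (simp add: exp_def)
  also have "\<dots> = exp 1 ^ k"
    by (simp flip: exp_of_nat_mult)
  also have "\<dots> \<le> 3 ^ k"
    using exp_le by (intro power_mono) auto
  finally show ?thesis
    by (simp add: power_divide field_simps)
qed

text \<open>Both sides estimate the number of pairs \<open>(p, j)\<close> with
  \<open>R p j\<close>.\<close>

lemma double_count_le:
  assumes "finite A" "finite J"
    and "\<And>j. j \<in> J \<Longrightarrow> t \<le> card {p \<in> A. R p j}"
    and "\<And>p. p \<in> A \<Longrightarrow> card {j \<in> J. R p j} \<le> k"
  shows "t * card J \<le> k * card A"
proof -
  have "t * card J \<le> (\<Sum>j\<in>J. card {p \<in> A. R p j})"
    using sum_bounded_below[of J t] assms(3) by (simp add: mult.commute)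
  also have "\<dots> = (\<Sum>p\<in>A. card {j \<in> J. R p j})"
    using assms(1,2) sum.swap by (simp only: card_eq_sum sum.inter_filter)
  also have "\<dots> \<le> k * card A"
    using sum_bounded_above[of A _ k] assms(4) by (simp add: mult.commute)
  finally show ?thesis .
qed

section \<open>Edge-colored regular graphs\<close>

locale colored_graph =
  fixes V :: "'v set" and E :: "'v set set" and d :: nat and h :: "'v set \<Rightarrow> nat"
  assumes simple: "simple_graph V E"
    and regular: "regular V E d"
    and proper: "proper_edge_coloring E d h"
begin

lemma finite_V: "finite V"
  using simple by (simp add: simple_graph_def)

lemma edge_subset: "e \<in> E \<Longrightarrow> e \<subseteq> V"
  and edge_card: "e \<in> E \<Longrightarrow> card e = 2"
  using simple by (auto simp: simple_graph_def)

lemma finite_E: "finite E"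
  by (rule finite_subset[of _ "Pow V"]) (use edge_subset finite_V in auto)

lemma edge_finite: "e \<in> E \<Longrightarrow> finite e"
  using edge_subset finite_V finite_subset by blast

lemma color_range: "e \<in> E \<Longrightarrow> h e \<in> {1..d}"
  using proper by (simp add: proper_edge_coloring_def)

lemma same_color_eq:
  "\<lbrakk>e \<in> E; f \<in> E; x \<in> e; x \<in> f; h e = h f\<rbrakk> \<Longrightarrow> e = f"
  using proper unfolding proper_edge_coloring_def properly_colored_def by blast

text \<open>The \<open>d\<close> edges at \<open>x\<close> have distinct colors in
  \<open>{1..d}\<close>, so every color occurs among them.\<close>

lemma colored_neighbor_exists:
  assumes "x \<in> V" "j \<in> {1..d}"
  shows "\<exists>!y. {x, y} \<in> E \<and> h {x, y} = j"
proof -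
  let ?S = "{e \<in> E. x \<in> e}"
  have inj: "inj_on h ?S"
    using same_color_eq by (auto intro!: inj_onI)
  have "card (h ` ?S) = d"
    using card_image[OF inj] regular assms(1) by (simp add: regular_def)
  moreover have "h ` ?S \<subseteq> {1..d}"
    using color_range by auto
  ultimately have "h ` ?S = {1..d}"
    by (intro card_subset_eq) auto
  then obtain e where e: "e \<in> E" "x \<in> e" "h e = j"
    using assms(2) by (smt (verit) imageE mem_Collect_eq)
  obtain y where y: "e = {x, y}"
    using edge_card[OF e(1)] e(2) by (auto simp: card_2_iff)
  show ?thesis
  proof (rule ex1I[of _ y])
    show "{x, y} \<in> E \<and> h {x, y} = j" using e y by simp
  next
    fix z assume z: "{x, z} \<in> E \<and> h {x, z} = j"
    then have "{x, z} = {x, y}"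
      using e y by (intro same_color_eq[of _ _ x]) auto
    then show "z = y" by (auto simp: doubleton_eq_iff)
  qed
qed

text \<open>Each color class is a perfect matching, and \<open>nb j\<close> is the involution of
  \<open>V\<close> exchanging the ends of the edges of color \<open>j\<close>.\<close>

definition nb :: "nat \<Rightarrow> 'v \<Rightarrow> 'v" where
  "nb j x = (THE y. {x, y} \<in> E \<and> h {x, y} = j)"

lemma nb_edge: "{x, nb j x} \<in> E" and nb_color: "h {x, nb j x} = j"
  if "x \<in> V" "j \<in> {1..d}"
  using theI'[OF colored_neighbor_exists[OF that]] by (auto simp: nb_def)

lemma nb_eqI:
  assumes "{x, y} \<in> E" "h {x, y} = j"
  shows "nb j x = y"
proof -
  have "x \<in> V" "j \<in> {1..d}"
    using edge_subset[OF assms(1)] color_range[OF assms(1)] assms(2) by simp_all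
  then show ?thesis
    unfolding nb_def using assms by (intro the1_equality colored_neighbor_exists conjI)
qed

lemma nb_nb:
  assumes "x \<in> V" "j \<in> {1..d}"
  shows "nb j (nb j x) = x"
proof -
  have "{nb j x, x} = {x, nb j x}" by (rule insert_commute)
  then show ?thesis
    using nb_edge[OF assms] nb_color[OF assms] by (intro nb_eqI) metis+
qed

lemma nb_inj_color:
  assumes "x \<in> V" "i \<in> {1..d}" "j \<in> {1..d}" "nb i x = nb j x"
  shows "i = j"
  using nb_color[OF assms(1,2)] nb_color[OF assms(1,3)] unfolding assms(4) by (rule trans[OF sym])

lemma edge_eq:
  assumes "e \<in> E" "x \<in> e"
  shows "e = {x, nb (h e) x}"
proof -
  have "x \<in> V" "h e \<in> {1..d}" using assms edge_subset color_range by blast+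
  from nb_edge[OF this] nb_color[OF this] show ?thesis
    by (intro same_color_eq[OF assms(1) _ assms(2)]) simp_all
qed

section \<open>Two-colored 4-cycles\<close>

text \<open>A 2-colored 4-cycle through \<open>e\<close> is determined by its second color
  \<open>j\<close>: the image of \<open>e\<close> under \<open>nb j\<close> must be the edge
  opposite to \<open>e\<close>.\<close>

definition cycle_colors :: "'v set \<Rightarrow> nat set" where
  "cycle_colors e = {j \<in> {1..d}. j \<noteq> h e \<and> nb j ` e \<in> E \<and> h (nb j ` e) = h e}"

text \<open>A pair \<open>(e, j)\<close> names a cycle together with a distinguished edge, which
  will be the conflict edge to repair. The value is a 4-cycle of the graph only for
  \<open>j \<in> cycle_colors e\<close>.\<close>

definition cyc :: "'v set \<times> nat \<Rightarrow> 'v set set" where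
  "cyc p = {fst p, nb (snd p) ` fst p} \<union> (\<lambda>x. {x, nb (snd p) x}) ` fst p"

lemma cycle_colors_subset: "cycle_colors e \<subseteq> {1..d} - {h e}"
  by (auto simp: cycle_colors_def)

lemma cycle_colors_range: "j \<in> cycle_colors e \<Longrightarrow> j \<in> {1..d}"
  by (simp add: cycle_colors_def)

lemma finite_cycle_colors: "finite (cycle_colors e)"
  by (rule finite_subset[OF cycle_colors_subset]) simp

lemma cyc_cases:
  assumes "g \<in> cyc (e, j)"
  obtains "g = e" | "g = nb j ` e" | x where "x \<in> e" "g = {x, nb j x}"
  using assms by (auto simp: cyc_def)

lemma cyc_edge_colors:
  assumes "e \<in> E" "j \<in> cycle_colors e" "g \<in> cyc (e, j)"
  shows "g \<in> E \<and> h g \<in> {h e, j}"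
  using assms(3)
proof (cases rule: cyc_cases)
  case 3
  with assms nb_edge[of _ j] nb_color[of _ j] edge_subset show ?thesis
    by (auto simp: cycle_colors_def)
qed (use assms in \<open>auto simp: cycle_colors_def\<close>)

lemma cyc_vertices:
  assumes "g \<in> cyc (e, j)" "x \<in> g"
  shows "x \<in> e \<or> x \<in> nb j ` e"
  using assms by (auto simp: cyc_def)

text \<open>At an end of the opposite edge, the edge of color \<open>j\<close> leads back to
  \<open>e\<close> because \<open>nb j\<close> is an involution. This is why an interchange merely
  exchanges two colors at each vertex of the cycle.\<close>

lemma cyc_incident_edges:
  assumes "e \<in> E" "j \<in> cycle_colors e" "x \<in> e \<or> x \<in> nb j ` e"
  shows "{x, nb (h e) x} \<in> cyc (e, j)" "{x, nb j x} \<in> cyc (e, j)"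
proof -
  have j: "j \<in> {1..d}" "nb j ` e \<in> E" "h (nb j ` e) = h e"
    using assms(2) by (auto simp: cycle_colors_def)
  have "{x, nb (h e) x} \<in> cyc (e, j) \<and> {x, nb j x} \<in> cyc (e, j)"
    using assms(3)
  proof
    assume "x \<in> e"
    then show ?thesis
      using edge_eq[OF assms(1), of x] by (auto simp: cyc_def)
  next
    assume x: "x \<in> nb j ` e"
    then obtain y where y: "y \<in> e" "x = nb j y" by auto
    moreover have "nb j x = y"
      using y nb_nb[of y j] edge_subset[OF assms(1)] j by auto
    ultimately have "{x, nb j x} = {y, nb j y}"
      by (simp add: insert_commute)
    then show ?thesis
      using y edge_eq[OF j(2) x] j(3) by (auto simp: cyc_def)
  qed
  then show "{x, nb (h e) x} \<in> cyc (e, j)" "{x, nb j x} \<in> cyc (e, j)" by auto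
qed

text \<open>Adjacent edges differ in color and only two colors occur, so opposite edges agree. The
  second color is that of \<open>{v, w}\<close>, whose \<open>nb\<close> carries \<open>u\<close> to
  \<open>x\<close> and \<open>v\<close> to \<open>w\<close>.\<close>

lemma four_cycle_eq_cyc:
  assumes "distinct [u, v, w, x]"
    and C: "C = {{u, v}, {v, w}, {w, x}, {x, u}}"
    and "C \<subseteq> E" "two_colored h C"
  shows "\<exists>j \<in> cycle_colors {u, v}. C = cyc ({u, v}, j)"
proof -
  let ?q = "h {v, w}"
  have E: "{u, v} \<in> E" "{v, w} \<in> E" "{w, x} \<in> E" "{x, u} \<in> E"
    using assms(3) unfolding C by simp_all
  have "{u, v} \<noteq> {v, w}" "{v, w} \<noteq> {w, x}" "{w, x} \<noteq> {x, u}" "{x, u} \<noteq> {u, v}"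
    using assms(1) by (auto simp: doubleton_eq_iff)
  then have ne: "h {u, v} \<noteq> ?q" "?q \<noteq> h {w, x}" "h {w, x} \<noteq> h {x, u}" "h {x, u} \<noteq> h {u, v}"
    using same_color_eq[OF E(1,2), of v] same_color_eq[OF E(2,3), of w]
      same_color_eq[OF E(3,4), of x] same_color_eq[OF E(4,1), of u]
    by blast+
  have eq: "h {w, x} = h {u, v}" "h {x, u} = ?q"
  proof -
    have card: "card {h {u, v}, ?q, h {w, x}, h {x, u}} = 2"
      using assms(4) by (simp add: two_colored_def C)
    have set: "{h {u, v}, ?q} = {h {u, v}, ?q, h {w, x}, h {x, u}}"
      by (rule card_subset_eq) (use card ne(1) in simp_all)
    have "h {w, x} \<in> {h {u, v}, ?q, h {w, x}, h {x, u}}" "h {x, u} \<in> {h {u, v}, ?q, h {w, x}, h {x, u}}"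
      by simp_all
    then have "h {w, x} \<in> {h {u, v}, ?q}" "h {x, u} \<in> {h {u, v}, ?q}"
      by (simp_all only: set[symmetric])
    then show "h {w, x} = h {u, v}" "h {x, u} = ?q"
      using ne by auto
  qed
  have nb: "nb ?q u = x" "nb ?q v = w" "nb ?q w = v"
  proof -
    have *: "{u, x} = {x, u}" "{w, v} = {v, w}" by auto
    show "nb ?q u = x" "nb ?q v = w" "nb ?q w = v"
      by (rule nb_eqI; use E eq * in simp)+
  qed
  have "?q \<in> cycle_colors {u, v}"
    using E eq ne nb color_range[OF E(2)] insert_commute[of x w "{}"]
    by (simp add: cycle_colors_def)
  moreover have "C = cyc ({u, v}, ?q)"
  proof -
    have "{x, w} = {w, x}" "{u, x} = {x, u}" by auto
    then show ?thesis
      unfolding C cyc_def fst_conv snd_conv image_insert image_empty nb by blast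
  qed
  ultimately show ?thesis by blast
qed

text \<open>Every cycle counted in \<open>standard_coloring\<close> is \<open>cyc (e, j)\<close> for
  some \<open>j\<close>, so there are at least as many second colors as cycles.\<close>

lemma card_cycle_colors:
  assumes "standard_coloring E d s h" "e \<in> E"
  shows "s - 1 \<le> card (cycle_colors e)"
proof -
  let ?Cs = "{C. four_cycle E C \<and> e \<in> C \<and> two_colored h C}"
  have "?Cs \<subseteq> (\<lambda>j. cyc (e, j)) ` cycle_colors e"
  proof
    fix C assume "C \<in> ?Cs"
    then obtain u v w x where D: "distinct [u, v, w, x]"
      and C: "C = {{u, v}, {v, w}, {w, x}, {x, u}}"
      and CE: "C \<subseteq> E" "two_colored h C" and e: "e \<in> C"
      unfolding four_cycle_def by blast
    \<comment> \<open>The vertices are renumbered cyclically to make \<open>e\<close> the first edge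
      of the cycle.\<close>
    have rot: "{a, b, c, g} = {b, c, g, a}" for a b c g :: "'v set"
      by (simp add: insert_commute)
    consider "e = {u, v}" | "e = {v, w}" | "e = {w, x}" | "e = {x, u}"
      using e unfolding C insert_iff empty_iff by iprover
    then have "\<exists>j \<in> cycle_colors e. C = cyc (e, j)"
    proof cases
      case 1
      then show ?thesis using four_cycle_eq_cyc[OF D C CE] by (simp only:)
    next
      case 2
      have "distinct [v, w, x, u]"
        using D by auto
      moreover have "C = {{v, w}, {w, x}, {x, u}, {u, v}}"
        unfolding C by (rule rot)
      ultimately show ?thesis
        unfolding 2 by (rule four_cycle_eq_cyc[OF _ _ CE])
    next
      case 3
      have "distinct [w, x, u, v]"
        using D by auto
      moreover have "C = {{w, x}, {x, u}, {u, v}, {v, w}}"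
        unfolding C by (rule trans[OF rot rot])
      ultimately show ?thesis
        unfolding 3 by (rule four_cycle_eq_cyc[OF _ _ CE])
    next
      case 4
      have "distinct [x, u, v, w]"
        using D by auto
      moreover have "C = {{x, u}, {u, v}, {v, w}, {w, x}}"
        unfolding C by (rule rot[symmetric])
      ultimately show ?thesis
        unfolding 4 by (rule four_cycle_eq_cyc[OF _ _ CE])
    qed
    then show "C \<in> (\<lambda>j. cyc (e, j)) ` cycle_colors e" by auto
  qed
  then have "card ?Cs \<le> card (cycle_colors e)"
    by (rule surj_card_le[OF finite_cycle_colors])
  moreover have "s - 1 \<le> card ?Cs"
    using assms by (simp add: standard_coloring_def)
  ultimately show ?thesis by linarith
qed

section \<open>Interchanging the colors on disjoint cycles\<close>

text \<open>For edge-disjoint cycles, \<open>SOME\<close> has only one candidate.\<close>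

definition swap :: "('v set \<times> nat) set \<Rightarrow> 'v set \<Rightarrow> nat" where
  "swap A g = (if \<exists>p\<in>A. g \<in> cyc p
     then let p = SOME p. p \<in> A \<and> g \<in> cyc p in if h g = snd p then h (fst p) else snd p
     else h g)"

lemma swap_in_cycle:
  assumes "disjoint_family_on cyc A" "(e, j) \<in> A" "g \<in> cyc (e, j)"
  shows "swap A g = (if h g = j then h e else j)"
proof -
  have "(SOME p. p \<in> A \<and> g \<in> cyc p) = (e, j)"
  proof (rule some_equality)
    show "p = (e, j)" if "p \<in> A \<and> g \<in> cyc p" for p
      using assms that unfolding disjoint_family_on_def by blast
  qed (use assms in auto)
  then show ?thesis
    using assms unfolding swap_def by auto
qed

lemma swap_outside: "\<forall>p\<in>A. g \<notin> cyc p \<Longrightarrow> swap A g = h g"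
  by (auto simp: swap_def)

lemma swap_proper:
  assumes disj: "disjoint_family_on cyc A"
    and A: "\<And>e j. (e, j) \<in> A \<Longrightarrow> e \<in> E \<and> j \<in> cycle_colors e"
  shows "proper_edge_coloring E d (swap A)"
proof -
  have step: "{x, nb (swap A g) x} \<in> cyc (e, j) \<and> h g \<in> {h e, j} \<and> swap A g \<in> {h e, j} \<and> h g \<noteq> swap A g"
    if "(e, j) \<in> A" "g \<in> cyc (e, j)" "x \<in> g" for g x e j
  proof -
    have "j \<noteq> h e" using A[OF that(1)] by (auto simp: cycle_colors_def)
    then show ?thesis
      using cyc_edge_colors[OF _ _ that(2)] cyc_incident_edges[of e j x] cyc_vertices[OF that(2,3)]
        A[OF that(1)] swap_in_cycle[OF disj that(1,2)] by auto
  qed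
  have range: "swap A g \<in> {1..d}" if "g \<in> E" for g
  proof (cases "\<exists>p\<in>A. g \<in> cyc p")
    case True
    then obtain e j where "(e, j) \<in> A" "g \<in> cyc (e, j)" by auto
    then show ?thesis
      using swap_in_cycle[OF disj] A color_range by (auto simp: cycle_colors_def)
  next
    case False
    then show ?thesis using that color_range swap_outside[of A g] by auto
  qed
  have "f = g" if fg: "f \<in> E" "g \<in> E" "x \<in> f" "x \<in> g" "swap A f = swap A g" for f g x
  proof -
    have x: "x \<in> V" using fg edge_subset by auto
    \<comment> \<open>\<open>?k\<close> is the edge at \<open>x\<close> whose old color is the
      common new color of \<open>f\<close> and \<open>g\<close>. If a chosen cycle contains
      \<open>?k\<close>, it also contains \<open>f\<close> and \<open>g\<close>, and both had the
      other color of that cycle. If none does, neither \<open>f\<close> nor \<open>g\<close> lies on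
      a chosen cycle and both equal \<open>?k\<close>.\<close>
    let ?k = "{x, nb (swap A f) x}"
    have no: "?k = f'" if "f' \<in> E" "x \<in> f'" "swap A f' = swap A f" "\<forall>p\<in>A. f' \<notin> cyc p" for f'
      using swap_outside[OF that(4)] edge_eq[OF that(1,2)] that(3) by simp
    show ?thesis
    proof (cases "\<exists>p\<in>A. ?k \<in> cyc p")
      case True
      then obtain e j where ej: "(e, j) \<in> A" "?k \<in> cyc (e, j)" by auto
      have in_cyc: "f' \<in> cyc (e, j)" if f': "f' \<in> E" "x \<in> f'" "swap A f' = swap A f" for f'
      proof -
        obtain p where p: "p \<in> A" "f' \<in> cyc p"
          using no[OF f'] ej by metis
        then have "?k \<in> cyc p"
          using step[of "fst p" "snd p" f' x] f' by auto
        then have "p = (e, j)"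
          using disj p ej by (auto simp: disjoint_family_on_def)
        then show ?thesis using p by simp
      qed
      have "h f = h g"
        using step[OF ej(1) in_cyc[OF fg(1,3)], of x] step[OF ej(1) in_cyc[OF fg(2,4)], of x] fg
        by auto
      then show ?thesis using same_color_eq fg by blast
    next
      case False
      have "\<forall>p\<in>A. f' \<notin> cyc p" if f': "f' \<in> E" "x \<in> f'" "swap A f' = swap A f" for f'
        using step[of _ _ f' x] f' False by force
      then show ?thesis using no fg by metis
    qed
  qed
  then show ?thesis
    using range unfolding proper_edge_coloring_def properly_colored_def by blast
qed

section \<open>Distances\<close>

definition adj :: "('v \<times> 'v) set" where
  "adj = {(u, v). {u, v} \<in> E}"

text \<open>Walks replace the paths of \<open>edge_dist\<close> because they can be concatenated
  even if vertices repeat.\<close>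

definition reach :: "nat \<Rightarrow> 'v \<Rightarrow> 'v \<Rightarrow> bool" where
  "reach k x y \<longleftrightarrow> (\<exists>l\<le>k. (x, y) \<in> adj ^^ l)"

definition near :: "nat \<Rightarrow> 'v \<Rightarrow> 'v set set" where
  "near k x = {e \<in> E. \<exists>y\<in>e. reach k x y}"

lemma reach_refl: "reach k x x"
  unfolding reach_def by (intro exI[of _ 0]) simp

lemma reach_trans:
  assumes "reach k x y" "reach l y z"
  shows "reach (k + l) x z"
proof -
  obtain a b where "a \<le> k" "(x, y) \<in> adj ^^ a" "b \<le> l" "(y, z) \<in> adj ^^ b"
    using assms unfolding reach_def by blast
  then have "a + b \<le> k + l" "(x, z) \<in> adj ^^ (a + b)"
    unfolding relpow_add by (simp, blast)
  then show ?thesis unfolding reach_def by blast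
qed

lemma reach_edge:
  assumes "e \<in> E" "x \<in> e" "y \<in> e"
  shows "reach 1 x y"
proof (cases "x = y")
  case False
  then have "e = {x, y}"
    using edge_card[OF assms(1)] assms(2,3) by (auto simp: card_2_iff)
  then have "(x, y) \<in> adj ^^ 1"
    using assms(1) by (simp add: adj_def)
  then show ?thesis unfolding reach_def by blast
qed (simp add: reach_refl)

lemma reach_sym: "reach k x y \<Longrightarrow> reach k y x"
proof -
  have "(x, y) \<in> adj ^^ l \<Longrightarrow> (y, x) \<in> adj ^^ l" for l
  proof (induction l arbitrary: y)
    case (Suc l)
    then obtain z where z: "(x, z) \<in> adj ^^ l" "{z, y} \<in> E"
    by (auto simp: adj_def)
    then have "(y, z) \<in> adj"
      by (simp add: adj_def insert_commute)
    then show ?case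
      using Suc.IH[OF z(1)] by (meson relpow_Suc_I2)
  qed simp
  then show "reach k x y \<Longrightarrow> reach k y x" by (auto simp: reach_def)
qed

lemma reach_mono: "reach k x y \<Longrightarrow> k \<le> l \<Longrightarrow> reach l x y"
  unfolding reach_def by (meson order_trans)

lemma near_mono: "k \<le> l \<Longrightarrow> near k x \<subseteq> near l x"
  unfolding near_def using reach_mono by blast

lemma near_trans:
  assumes "reach k x y" "e \<in> near l y"
  shows "e \<in> near (k + l) x"
  using assms reach_trans unfolding near_def by blast

text \<open>The summand 1 pays for the step along \<open>e\<close> from \<open>u\<close> to the end
  that is reached from \<open>x\<close>.\<close>

lemma near_trans_edge:
  assumes "e \<in> near k x" "f \<in> near l x" "u \<in> e"
  shows "f \<in> near (1 + k + l) u"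
proof -
  obtain y where y: "y \<in> e" "reach k x y" "e \<in> E"
    using assms(1) by (auto simp: near_def)
  have "reach (1 + k) u x"
    using reach_trans[OF reach_edge[OF y(3) assms(3) y(1)] reach_sym[OF y(2)]] .
  then show ?thesis using near_trans assms(2) by blast
qed

text \<open>If the next vertex of the walk already lies on the path, the path is cut off there;
  hence only an upper bound on the length.\<close>

lemma relpow_path:
  assumes "(x, y) \<in> adj ^^ l" "x \<in> V"
  shows "\<exists>p. path V E p \<and> hd p = x \<and> last p = y \<and> length p \<le> l + 1"
  using assms(1)
proof (induction l arbitrary: y)
  case 0
  then show ?case
    using assms(2) by (intro exI[of _ "[x]"]) (auto simp: path_def)
next
  case (Suc l)
  then obtain z where z: "(x, z) \<in> adj ^^ l" "{z, y} \<in> E"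
    by (auto simp: adj_def)
  then obtain p where p: "path V E p" "hd p = x" "last p = z" "length p \<le> l + 1"
    using Suc.IH by blast
  show ?case
  proof (cases "y \<in> set p")
    case False
    then have "path V E (p @ [y])"
      using p(1,3) z(2) edge_subset[OF z(2)] by (auto simp: path_def successively_append_iff)
    then show ?thesis
      using p by (intro exI[of _ "p @ [y]"]) (auto simp: path_def)
  next
    case True
    then obtain a b where ab: "p = (a @ [y]) @ b"
      by (metis split_list append.assoc append_Cons append_Nil)
    then have "path V E (a @ [y])"
      using p(1) unfolding path_def ab by (auto simp: successively_append_iff)
    then show ?thesis
      using p ab by (intro exI[of _ "a @ [y]"]) (auto simp: hd_append)
  qed
qed

text \<open>This allows the sparsity condition for neighborhoods of edges to be used around a
  vertex.\<close>

lemma near_subset_neighborhood: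
  assumes "f \<in> E" "x \<in> f"
  shows "near k x \<subseteq> neighborhood V E k f"
proof
  fix e assume "e \<in> near k x"
  then obtain y l where y: "e \<in> E" "y \<in> e" "l \<le> k" "(x, y) \<in> adj ^^ l"
    by (auto simp: near_def reach_def)
  obtain p where p: "path V E p" "hd p = x" "last p = y" "length p \<le> l + 1"
    using relpow_path[OF y(4)] assms edge_subset by blast
  have "edge_dist V E f e \<le> enat (length p - 1)"
    unfolding edge_dist_def using p y(2) assms(2) by (intro Inf_lower) blast
  also have "\<dots> \<le> enat k" using p(4) y(3) by simp
  finally show "e \<in> neighborhood V E k f"
    using y(1) by (simp add: neighborhood_def)
qed

lemma cyc_cover_near:
  assumes "f \<in> E" "k \<in> {1..d}" "y \<in> f \<or> y \<in> nb k ` f"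
  shows "f \<in> near 1 y"
proof -
  have "\<exists>z\<in>f. reach 1 y z"
    using assms(3)
  proof
    assume "y \<in> f"
    then show ?thesis using reach_refl by blast
  next
    assume "y \<in> nb k ` f"
    then obtain z where z: "z \<in> f" "y = nb k z" by auto
    have "{z, nb k z} \<in> E"
      using nb_edge assms(1,2) edge_subset z by blast
    then have "reach 1 y z"
      using reach_edge z(2) by blast
    then show ?thesis using z(1) by blast
  qed
  then show ?thesis using assms(1) by (auto simp: near_def)
qed

end

section \<open>Greedy choice of disjoint cycles\<close>

text \<open>In the greedy choice at most \<open>T\<close> cycles may load a vertex outside their conflict edge, and a color
  may be chosen at most \<open>T\<close> times as second color near a vertex. As there are at most \<open>d * m\<close>
  conflict edges nearby, double counting leaves at most \<open>q\<close> exhausted colors and at most \<open>2 * q\<close>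
  exhausted vertices; the left-hand side of \<open>many_cycles\<close> adds up all choices that are ruled out.\<close>

locale sparse_conflicts = colored_graph V E d h
  for V :: "'v set" and E :: "'v set set" and d :: nat and h :: "'v set \<Rightarrow> nat" +
  fixes L :: "'v set \<Rightarrow> nat set" and \<rho> :: "nat \<Rightarrow> nat" and m \<kappa> T q :: nat
  assumes permutes: "\<rho> permutes {1..d}"
    and finite_L: "e \<in> E \<Longrightarrow> finite (L e)"
    and card_L: "e \<in> E \<Longrightarrow> card (L e) \<le> m"
    and vertex_sparse:
      "\<lbrakk>x \<in> V; a \<in> {1..d}\<rbrakk> \<Longrightarrow> card {e \<in> E. x \<in> e \<and> a \<in> L e} \<le> m"
    and matching_sparse:
      "\<lbrakk>x \<in> V; i \<in> {1..d}; a \<in> {1..d}\<rbrakk> \<Longrightarrow>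
        card {e \<in> E. h e = i \<and> e \<in> near 6 x \<and> a \<in> L e} \<le> m"
    and few_conflicts: "x \<in> V \<Longrightarrow> card {e \<in> E. x \<in> e \<and> \<rho> (h e) \<in> L e} \<le> \<kappa>"
    and few_opposite:
      "e \<in> E \<Longrightarrow> card {j \<in> cycle_colors e. \<rho> j \<in> L (nb j ` e)} \<le> \<kappa>"
    and many_cycles: "e \<in> E \<Longrightarrow> 7 * m + 5 * \<kappa> + 8 * T + 5 * q < card (cycle_colors e)"
    and T_pos: "0 < T"
    and dm_le: "d * m \<le> T * q"
begin

section \<open>Conflict edges and balanced families of cycles\<close>

definition conflicts :: "'v set set" where
  "conflicts = {e \<in> E. \<rho> (h e) \<in> L e}"

text \<open>After the interchange and \<open>\<rho>\<close>, the two edges of color \<open>j\<close>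
  on the cycle receive \<open>\<rho> (h e)\<close>, while \<open>e\<close> and its opposite edge
  receive \<open>\<rho> j\<close>. The conditions say that all four edges accept their new
  color.\<close>

definition allowed :: "'v set \<Rightarrow> nat set" where
  "allowed e = {j \<in> cycle_colors e.
     (\<forall>x\<in>e. \<rho> (h e) \<notin> L {x, nb j x}) \<and> \<rho> j \<notin> L e \<and> \<rho> j \<notin> L (nb j ` e)}"

text \<open>The two bounds by \<open>T\<close> are the invariants of the greedy choice. The first
  serves \<open>card_used_side\<close>, the second \<open>card_used_opposite\<close>.\<close>

definition balanced :: "('v set \<times> nat) set \<Rightarrow> bool" where
  "balanced A \<longleftrightarrow> A \<subseteq> Sigma conflicts allowed \<and> disjoint_family_on cyc A \<and>
     (\<forall>x. card {p \<in> A. x \<in> nb (snd p) ` fst p} \<le> T) \<and>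
     (\<forall>x j. card {p \<in> A. snd p = j \<and> fst p \<in> near 2 x} \<le> T)"

lemma rho_range: "i \<in> {1..d} \<Longrightarrow> \<rho> i \<in> {1..d}"
  using permutes by (simp only: permutes_in_image)

lemma rho_inj: "inj_on \<rho> J"
  using permutes permutes_inj inj_on_subset by blast

lemma finite_choices: "finite (Sigma conflicts allowed)"
  by (intro finite_SigmaI) (use finite_E finite_cycle_colors in \<open>auto simp: conflicts_def allowed_def\<close>)

lemma nb_inj_on: "x \<in> V \<Longrightarrow> inj_on (\<lambda>j. nb j x) (cycle_colors e)"
  using nb_inj_color[of x] cycle_colors_subset by (intro inj_onI) blast

text \<open>A conflict edge of color \<open>i\<close> has \<open>\<rho> i\<close> in its list, so
  \<open>matching_sparse\<close> bounds each of the \<open>d\<close> color classes by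
  \<open>m\<close>.\<close>

lemma card_conflicts_near:
  assumes "x \<in> V"
  shows "card (conflicts \<inter> near 6 x) \<le> d * m"
proof -
  let ?C = "\<lambda>i. {e \<in> E. h e = i \<and> e \<in> near 6 x \<and> \<rho> i \<in> L e}"
  have "conflicts \<inter> near 6 x \<subseteq> (\<Union>i\<in>{1..d}. ?C i)"
    using color_range by (auto simp: conflicts_def)
  then have "card (conflicts \<inter> near 6 x) \<le> card (\<Union>i\<in>{1..d}. ?C i)"
    using finite_E by (intro card_mono) auto
  also have "\<dots> \<le> (\<Sum>i\<in>{1..d}. card (?C i))"
    by (rule card_UN_le) simp
  also have "\<dots> \<le> d * m"
    using sum_bounded_above[of "{1..d}" "\<lambda>i. card (?C i)" m] matching_sparse[OF assms] rho_range
    by simp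
  finally show ?thesis .
qed

section \<open>Choices ruled out by a balanced family\<close>

context
  fixes A assumes A: "balanced A"
begin

lemma A_choice:
  assumes "p \<in> A"
  shows "fst p \<in> conflicts" "fst p \<in> E" "snd p \<in> cycle_colors (fst p)" "snd p \<in> {1..d}"
proof -
  have "p \<in> Sigma conflicts allowed"
    using A assms unfolding balanced_def by blast
  then show "fst p \<in> conflicts" "fst p \<in> E" "snd p \<in> cycle_colors (fst p)"
    by (auto simp: conflicts_def allowed_def)
  then show "snd p \<in> {1..d}" by (simp only: cycle_colors_range)
qed

lemma finite_A: "finite A"
  using A finite_choices finite_subset unfolding balanced_def by blast

text \<open>Disjoint cycles cannot share a conflict edge, so pairs in \<open>A\<close> may be
  counted by their conflict edges.\<close>

lemma inj_fst: "inj_on fst A"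
proof (rule inj_onI)
  fix p r assume "p \<in> A" "r \<in> A" "fst p = fst r"
  moreover have "fst p \<in> cyc p" "fst r \<in> cyc r" by (simp_all add: cyc_def)
  ultimately show "p = r"
    using A unfolding balanced_def disjoint_family_on_def by (metis IntI empty_iff)
qed

lemma card_A_le:
  assumes "finite F" "\<And>p. p \<in> A \<Longrightarrow> P p \<Longrightarrow> fst p \<in> F" "card F \<le> b"
  shows "card {p \<in> A. P p} \<le> b"
proof -
  have "card {p \<in> A. P p} \<le> card F"
    by (rule card_inj_on_le[of fst]) (use assms(1,2) inj_on_subset[OF inj_fst] in auto)
  then show ?thesis using assms(3) by simp
qed

lemma card_A_near:
  assumes "x \<in> V"
  shows "card {p \<in> A. fst p \<in> near 6 x} \<le> d * m"
  using finite_E A_choice card_conflicts_near[OF assms]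
  by (intro card_A_le[of "conflicts \<inter> near 6 x"]) (auto simp: conflicts_def)

lemma card_UN_A_le:
  assumes "\<And>p. p \<in> A \<Longrightarrow> card (X p) \<le> k" "card {p \<in> A. P p} \<le> b"
  shows "card (\<Union>p\<in>{p \<in> A. P p}. X p) \<le> k * b"
proof -
  have "card (\<Union>p\<in>{p \<in> A. P p}. X p) \<le> (\<Sum>p\<in>{p \<in> A. P p}. card (X p))"
    using finite_A by (intro card_UN_le) simp
  also have "\<dots> \<le> card {p \<in> A. P p} * k"
    using sum_bounded_above[of "{p \<in> A. P p}" "\<lambda>p. card (X p)" k] assms(1) by simp
  also have "\<dots> \<le> b * k" using assms(2) by simp
  finally show ?thesis by (simp add: mult.commute)
qed

text \<open>The conflict edge is at most one step from each vertex of its cycle, and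
  \<open>nb j x\<close> is one step from \<open>x\<close>. This explains the radius 2 in
  \<open>balanced\<close>.\<close>

lemma nb_near:
  assumes "p \<in> A" "x \<in> V" "j \<in> {1..d}" "nb j x \<in> fst p \<or> nb j x \<in> nb (snd p) ` fst p"
  shows "fst p \<in> near 2 x"
proof -
  have "fst p \<in> near 1 (nb j x)"
    using cyc_cover_near A_choice[OF assms(1)] assms(4) by blast
  moreover have "reach 1 x (nb j x)"
    using reach_edge nb_edge[OF assms(2,3)] by blast
  ultimately show ?thesis using near_trans[of 1 x "nb j x" _ 1] by (simp add: numeral_2_eq_2)
qed

context
  fixes e x assumes e: "e \<in> E" and x: "x \<in> e"
begin

lemma xV: "x \<in> V"
  using e x edge_subset by blast

text \<open>Distinct \<open>j\<close> give distinct edges at \<open>x\<close>, all with the same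
  color \<open>\<rho> (h e)\<close> in their lists, so \<open>vertex_sparse\<close> applies.\<close>

lemma card_forbidden_side: "card {j \<in> cycle_colors e. \<rho> (h e) \<in> L {x, nb j x}} \<le> m"
proof -
  have "card {j \<in> cycle_colors e. \<rho> (h e) \<in> L {x, nb j x}}
      \<le> card {g \<in> E. x \<in> g \<and> \<rho> (h e) \<in> L g}"
  proof (rule card_inj_on_le)
    show "inj_on (\<lambda>j. {x, nb j x}) {j \<in> cycle_colors e. \<rho> (h e) \<in> L {x, nb j x}}"
      using nb_inj_on[OF xV, of e] unfolding inj_on_def doubleton_eq_iff by auto
    show "(\<lambda>j. {x, nb j x}) ` {j \<in> cycle_colors e. \<rho> (h e) \<in> L {x, nb j x}}
        \<subseteq> {g \<in> E. x \<in> g \<and> \<rho> (h e) \<in> L g}"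
      using nb_edge[OF xV] cycle_colors_subset by blast
  qed (use finite_E in simp)
  then show ?thesis
    using vertex_sparse[OF xV rho_range[OF color_range[OF e]]] by linarith
qed

text \<open>A cycle through \<open>x\<close> blocks only its own two colors there. At most
  \<open>\<kappa>\<close> cycles have \<open>x\<close> on their conflict edge, and at most
  \<open>T\<close> have it on the opposite edge.\<close>

lemma card_used_side: "card {j \<in> cycle_colors e. {x, nb j x} \<in> \<Union> (cyc ` A)} \<le> 2 * (\<kappa> + T)"
proof -
  let ?P = "\<lambda>p. x \<in> fst p \<or> x \<in> nb (snd p) ` fst p"
  have "{j \<in> cycle_colors e. {x, nb j x} \<in> \<Union> (cyc ` A)}
      \<subseteq> (\<Union>p\<in>{p \<in> A. ?P p}. {h (fst p), snd p})"
  proof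
    fix j assume "j \<in> {j \<in> cycle_colors e. {x, nb j x} \<in> \<Union> (cyc ` A)}"
    then obtain p where j: "j \<in> {1..d}" and p: "p \<in> A" "{x, nb j x} \<in> cyc (fst p, snd p)"
      using cycle_colors_range[of j e] by auto
    have "j \<in> {h (fst p), snd p}"
      using cyc_edge_colors[OF A_choice(2,3)[OF p(1)] p(2)] nb_color[OF xV j] by simp
    moreover have "p \<in> {p \<in> A. ?P p}"
      using cyc_vertices[OF p(2), of x] p(1) by simp
    ultimately show "j \<in> (\<Union>p\<in>{p \<in> A. ?P p}. {h (fst p), snd p})"
      by (rule UN_I[rotated])
  qed
  then have "card {j \<in> cycle_colors e. {x, nb j x} \<in> \<Union> (cyc ` A)}
      \<le> card (\<Union>p\<in>{p \<in> A. ?P p}. {h (fst p), snd p})"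
    using finite_A by (intro card_mono) auto
  also have "\<dots> \<le> 2 * (\<kappa> + T)"
  proof (rule card_UN_A_le)
    have "card {p \<in> A. x \<in> fst p} \<le> \<kappa>"
      using finite_E A_choice few_conflicts[OF xV]
      by (intro card_A_le[of "{g \<in> E. x \<in> g \<and> \<rho> (h g) \<in> L g}"]) (auto simp: conflicts_def)
    moreover have "card {p \<in> A. x \<in> nb (snd p) ` fst p} \<le> T"
      using A by (simp add: balanced_def)
    moreover have "{p \<in> A. ?P p} = {p \<in> A. x \<in> fst p} \<union> {p \<in> A. x \<in> nb (snd p) ` fst p}"
      by auto
    then have "card {p \<in> A. ?P p} \<le> card {p \<in> A. x \<in> fst p} + card {p \<in> A. x \<in> nb (snd p) ` fst p}"
      by (simp only: card_Un_le)
    ultimately show "card {p \<in> A. ?P p} \<le> \<kappa> + T"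
      by linarith
  qed (simp add: card_insert_if)
  finally show ?thesis .
qed

text \<open>Each chosen cycle loads the two ends of its opposite edge, hence at most two of the
  vertices \<open>nb j x\<close>. The at most \<open>d * m\<close> cycles nearby can therefore fill
  at most \<open>2 * q\<close> of these vertices up to \<open>T\<close>.\<close>

lemma card_overloaded_end:
  "card {j \<in> cycle_colors e. T \<le> card {p \<in> A. nb j x \<in> nb (snd p) ` fst p}} \<le> 2 * q"
proof -
  let ?J = "{j \<in> cycle_colors e. T \<le> card {p \<in> A. nb j x \<in> nb (snd p) ` fst p}}"
  let ?A = "{p \<in> A. fst p \<in> near 6 x}"
  have "T * card ?J \<le> 2 * card ?A"
  proof (rule double_count_le)
    fix j assume j: "j \<in> ?J"
    then have "j \<in> {1..d}" using cycle_colors_range[of j e] by simp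
    then have "{p \<in> A. nb j x \<in> nb (snd p) ` fst p} \<subseteq> {p \<in> ?A. nb j x \<in> nb (snd p) ` fst p}"
      using nb_near[OF _ xV, of _ j] near_mono[of 2 6 x] by auto
    then have "card {p \<in> A. nb j x \<in> nb (snd p) ` fst p}
        \<le> card {p \<in> ?A. nb j x \<in> nb (snd p) ` fst p}"
      using finite_A by (intro card_mono) auto
    then show "T \<le> card {p \<in> ?A. nb j x \<in> nb (snd p) ` fst p}"
      using j by simp
  next
    fix p assume "p \<in> ?A"
    then have p: "card (fst p) = 2" "finite (fst p)"
      using A_choice edge_card edge_finite by auto
    have "card {j \<in> ?J. nb j x \<in> nb (snd p) ` fst p} \<le> card (nb (snd p) ` fst p)"
      by (rule card_inj_on_le[of "\<lambda>j. nb j x"])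
        (use p in \<open>auto intro: inj_on_subset[OF nb_inj_on[OF xV, of e]]\<close>)
    also have "\<dots> \<le> 2" using card_image_le[OF p(2), of "nb (snd p)"] p(1) by simp
    finally show "card {j \<in> ?J. nb j x \<in> nb (snd p) ` fst p} \<le> 2" .
  qed (use finite_A finite_cycle_colors in auto)
  also have "\<dots> \<le> T * (2 * q)"
    using card_A_near[OF xV] dm_le by simp
  finally show ?thesis using T_pos by simp
qed

text \<open>Each of the at most \<open>d * m\<close> cycles nearby has a single second
  color.\<close>

lemma card_popular_color:
  "card {j \<in> cycle_colors e. T \<le> card {p \<in> A. snd p = j \<and> fst p \<in> near 6 x}} \<le> q"
proof -
  let ?J = "{j \<in> cycle_colors e. T \<le> card {p \<in> A. snd p = j \<and> fst p \<in> near 6 x}}"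
  let ?A = "{p \<in> A. fst p \<in> near 6 x}"
  have "T * card ?J \<le> 1 * card ?A"
  proof (rule double_count_le[where R = "\<lambda>p j. snd p = j"])
    fix j assume "j \<in> ?J"
    moreover have "{p \<in> A. snd p = j \<and> fst p \<in> near 6 x} = {p \<in> ?A. snd p = j}" by auto
    ultimately show "T \<le> card {p \<in> ?A. snd p = j}" by simp
  next
    fix p
    have "{j \<in> ?J. snd p = j} \<subseteq> {snd p}" by auto
    then show "card {j \<in> ?J. snd p = j} \<le> 1"
      using card_mono[of "{snd p}"] by fastforce
  qed (use finite_A finite_cycle_colors in auto)
  also have "\<dots> \<le> T * q"
    using card_A_near[OF xV] dm_le by simp
  finally show ?thesis using T_pos by simp
qed

text \<open>A cycle through the opposite edge has \<open>h e\<close> among its two colors. If its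
  conflict edge has color \<open>h e\<close>, \<open>matching_sparse\<close> leaves at most
  \<open>m\<close> cycles; if its second color is \<open>h e\<close>, balance leaves at most
  \<open>T\<close>. Each has four vertices, and \<open>nb j x\<close> determines
  \<open>j\<close>.\<close>

lemma card_used_opposite: "card {j \<in> cycle_colors e. nb j ` e \<in> \<Union> (cyc ` A)} \<le> 4 * (m + T)"
proof -
  let ?P = "\<lambda>p. fst p \<in> near 2 x \<and> (h (fst p) = h e \<or> snd p = h e)"
  let ?X = "\<lambda>p. fst p \<union> nb (snd p) ` fst p"
  have X: "finite (?X p) \<and> card (?X p) \<le> 4" if "p \<in> A" for p
  proof -
    have p: "card (fst p) = 2" "finite (fst p)"
      using A_choice[OF that] edge_card edge_finite by auto
    then show ?thesis
      using card_image_le[OF p(2), of "nb (snd p)"] card_Un_le[of "fst p" "nb (snd p) ` fst p"]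
      by simp
  qed
  have "card {j \<in> cycle_colors e. nb j ` e \<in> \<Union> (cyc ` A)} \<le> card (\<Union>p\<in>{p \<in> A. ?P p}. ?X p)"
  proof (rule card_inj_on_le[of "\<lambda>j. nb j x"])
    show "(\<lambda>j. nb j x) ` {j \<in> cycle_colors e. nb j ` e \<in> \<Union> (cyc ` A)}
        \<subseteq> (\<Union>p\<in>{p \<in> A. ?P p}. ?X p)"
    proof
      fix y assume "y \<in> (\<lambda>j. nb j x) ` {j \<in> cycle_colors e. nb j ` e \<in> \<Union> (cyc ` A)}"
      then obtain j p where j: "j \<in> cycle_colors e" and y: "y = nb j x"
        and p: "p \<in> A" "nb j ` e \<in> cyc (fst p, snd p)"
        by auto
      have "h e \<in> {h (fst p), snd p}"
        using cyc_edge_colors[OF A_choice(2,3)[OF p(1)] p(2)] j by (simp add: cycle_colors_def)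
      moreover have *: "nb j x \<in> fst p \<or> nb j x \<in> nb (snd p) ` fst p"
        using cyc_vertices[OF p(2), of "nb j x"] x by simp
      moreover have "fst p \<in> near 2 x"
        using nb_near[OF p(1) xV _ *] j by (simp add: cycle_colors_def)
      ultimately show "y \<in> (\<Union>p\<in>{p \<in> A. ?P p}. ?X p)"
        unfolding y using p(1) by (intro UN_I[of p]) auto
    qed
    show "inj_on (\<lambda>j. nb j x) {j \<in> cycle_colors e. nb j ` e \<in> \<Union> (cyc ` A)}"
      by (rule inj_on_subset[OF nb_inj_on[OF xV, of e]]) simp
  qed (use X finite_A in auto)
  also have "\<dots> \<le> 4 * (m + T)"
  proof (rule card_UN_A_le)
    let ?P1 = "{p \<in> A. h (fst p) = h e \<and> fst p \<in> near 6 x}"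
    let ?P2 = "{p \<in> A. snd p = h e \<and> fst p \<in> near 2 x}"
    have "\<rho> (h e) \<in> L (fst p)" if "p \<in> A" "h (fst p) = h e" for p
      using A_choice(1)[OF that(1)] that(2) by (simp add: conflicts_def)
    then have "card ?P1 \<le> m"
      using finite_E A_choice color_range[OF e]
        matching_sparse[OF xV color_range[OF e] rho_range[OF color_range[OF e]]]
      by (intro card_A_le[of "{g \<in> E. h g = h e \<and> g \<in> near 6 x \<and> \<rho> (h e) \<in> L g}"])
        auto
    moreover have "card ?P2 \<le> T"
      using A by (simp add: balanced_def)
    moreover have "card {p \<in> A. ?P p} \<le> card (?P1 \<union> ?P2)"
      using finite_A near_mono[of 2 6 x] by (intro card_mono) auto
    ultimately show "card {p \<in> A. ?P p} \<le> m + T"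
      using card_Un_le[of ?P1 ?P2] by linarith
  qed (use X in blast)
  finally show ?thesis .
qed

end

text \<open>The sizes of ten sets of bad colors add up to the bound in \<open>many_cycles\<close>,
  so some second color is outside all of them.\<close>

lemma extendable:
  assumes e: "e \<in> conflicts" "e \<notin> \<Union> (cyc ` A)"
  shows "\<exists>j. balanced (insert (e, j) A)"
proof -
  have eE: "e \<in> E" using e by (simp add: conflicts_def)
  then obtain u v where uv: "e = {u, v}"
    using edge_card[OF eE] unfolding card_2_iff by blast
  then have u: "u \<in> e" and v: "v \<in> e" by auto
  define F where "F x = {j \<in> cycle_colors e. \<rho> (h e) \<in> L {x, nb j x}}" for x
  define U where "U x = {j \<in> cycle_colors e. {x, nb j x} \<in> \<Union> (cyc ` A)}" for x
  define W where "W x = {j \<in> cycle_colors e. T \<le> card {p \<in> A. nb j x \<in> nb (snd p) ` fst p}}" for x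
  define P where "P = {j \<in> cycle_colors e. T \<le> card {p \<in> A. snd p = j \<and> fst p \<in> near 6 u}}"
  define Q where "Q = {j \<in> cycle_colors e. nb j ` e \<in> \<Union> (cyc ` A)}"
  define D where "D = {j \<in> cycle_colors e. \<rho> j \<in> L e}"
  define R where "R = {j \<in> cycle_colors e. \<rho> j \<in> L (nb j ` e)}"
  note bad_defs = F_def U_def W_def P_def Q_def D_def R_def
  let ?bad = "F u \<union> (F v \<union> (U u \<union> (U v \<union> (W u \<union> (W v \<union> (P \<union> (Q \<union> (D \<union> R))))))))"
  have "card D \<le> card (L e)"
    unfolding D_def using finite_L[OF eE] rho_inj by (intro card_inj_on_le[of \<rho>]) auto
  then have D: "card D \<le> m" using card_L[OF eE] by simp
  have R: "card R \<le> \<kappa>" unfolding R_def by (rule few_opposite[OF eE])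
  have un: "card (X \<union> Y) \<le> a + b" if "card X \<le> a" "card Y \<le> b" for X Y :: "nat set" and a b
    using card_Un_le[of X Y] that by linarith
  have "card ?bad \<le> m + (m + (2 * (\<kappa> + T) + (2 * (\<kappa> + T) + (2 * q + (2 * q +
      (q + (4 * (m + T) + (m + \<kappa>))))))))"
    using card_forbidden_side[OF eE u] card_forbidden_side[OF eE v]
      card_used_side[OF eE u] card_used_side[OF eE v]
      card_overloaded_end[OF eE u] card_overloaded_end[OF eE v]
      card_popular_color[OF eE u] card_used_opposite[OF eE u]
    unfolding bad_defs[symmetric] by (intro un D R)
  then have "card ?bad < card (cycle_colors e)"
    using many_cycles[OF eE] by simp
  moreover have "finite ?bad"
    unfolding bad_defs using finite_cycle_colors by simp
  ultimately have "\<not> cycle_colors e \<subseteq> ?bad"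
    using card_mono[of ?bad "cycle_colors e"] by linarith
  then obtain j where j: "j \<in> cycle_colors e" "j \<notin> ?bad" by blast
  have ends: "\<rho> (h e) \<notin> L {x, nb j x} \<and> {x, nb j x} \<notin> \<Union> (cyc ` A) \<and>
      card {p \<in> A. nb j x \<in> nb (snd p) ` fst p} < T" if "x \<in> e" for x
  proof -
    have "x = u \<or> x = v" using that unfolding uv by blast
    then have "j \<notin> F x" "j \<notin> U x" "j \<notin> W x"
      using j(2) unfolding Un_iff by iprover+
    then show ?thesis using j(1) by (simp add: F_def U_def W_def)
  qed
  have other: "card {p \<in> A. snd p = j \<and> fst p \<in> near 6 u} < T"
      "nb j ` e \<notin> \<Union> (cyc ` A)" "\<rho> j \<notin> L e" "\<rho> j \<notin> L (nb j ` e)"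
  proof -
    have "j \<notin> P" "j \<notin> Q" "j \<notin> D" "j \<notin> R"
      using j(2) unfolding Un_iff by iprover+
    then show "card {p \<in> A. snd p = j \<and> fst p \<in> near 6 u} < T"
        "nb j ` e \<notin> \<Union> (cyc ` A)" "\<rho> j \<notin> L e" "\<rho> j \<notin> L (nb j ` e)"
      using j(1) by (simp_all add: P_def Q_def D_def R_def)
  qed
  have suc: "card (insert (e, j) X) \<le> Suc (card X)" for X
    by (cases "finite X") (simp_all add: card_insert_if)
  have "j \<in> allowed e"
    using j(1) ends other by (simp add: allowed_def)
  moreover have "cyc (e, j) \<inter> cyc p = {}" if "p \<in> A" for p
  proof -
    have "g \<notin> cyc p" if "g \<in> cyc (e, j)" for g
      using that
    proof (cases rule: cyc_cases)
      case 1
      then show ?thesis using e(2) \<open>p \<in> A\<close> by blast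
    next
      case 2
      then show ?thesis using other(2) \<open>p \<in> A\<close> by blast
    next
      case (3 x)
      then show ?thesis using ends \<open>p \<in> A\<close> by blast
    qed
    then show ?thesis by blast
  qed
  moreover have "card {p \<in> insert (e, j) A. x \<in> nb (snd p) ` fst p} \<le> T" for x
  proof -
    have old: "card {p \<in> A. x \<in> nb (snd p) ` fst p} \<le> T"
      using A by (simp add: balanced_def)
    show ?thesis
    proof (cases "x \<in> nb j ` e")
      case True
      then have "card {p \<in> A. x \<in> nb (snd p) ` fst p} < T"
        using ends by blast
      moreover have "{p \<in> insert (e, j) A. x \<in> nb (snd p) ` fst p}
          \<subseteq> insert (e, j) {p \<in> A. x \<in> nb (snd p) ` fst p}" by auto
      then have "card {p \<in> insert (e, j) A. x \<in> nb (snd p) ` fst p}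
          \<le> card (insert (e, j) {p \<in> A. x \<in> nb (snd p) ` fst p})"
        using finite_A by (intro card_mono) auto
      ultimately show ?thesis
        using suc[of "{p \<in> A. x \<in> nb (snd p) ` fst p}"] by linarith
    next
      case False
      then have "{p \<in> insert (e, j) A. x \<in> nb (snd p) ` fst p} = {p \<in> A. x \<in> nb (snd p) ` fst p}"
        by auto
      then show ?thesis using old by simp
    qed
  qed
  moreover have "card {p \<in> insert (e, j) A. snd p = k \<and> fst p \<in> near 2 x} \<le> T" for x k
  proof (cases "k = j \<and> e \<in> near 2 x")
    case True
    let ?S = "{p \<in> A. snd p = j \<and> fst p \<in> near 6 u}"
    \<comment> \<open>Going through \<open>e\<close>, every edge of \<open>near 2 x\<close> is
      within \<open>1 + 2 + 2\<close> of \<open>u\<close>. So excluding the colors that are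
      exhausted around the single vertex \<open>u\<close> preserves the bound at every
      \<open>x\<close>.\<close>
    have "near 2 x \<subseteq> near 6 u"
      using True near_trans_edge[of e 2 x _ 2 u] near_mono[of "1 + 2 + 2" 6 u] u by auto
    then have "{p \<in> insert (e, j) A. snd p = k \<and> fst p \<in> near 2 x} \<subseteq> insert (e, j) ?S"
      using True by auto
    then have "card {p \<in> insert (e, j) A. snd p = k \<and> fst p \<in> near 2 x} \<le> card (insert (e, j) ?S)"
      using finite_A by (intro card_mono) auto
    also have "\<dots> \<le> Suc (card ?S)"
      by (rule suc)
    also have "\<dots> \<le> T"
      using other(1) by simp
    finally show ?thesis .
  next
    case False
    then have "{p \<in> insert (e, j) A. snd p = k \<and> fst p \<in> near 2 x}
        = {p \<in> A. snd p = k \<and> fst p \<in> near 2 x}"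
      by auto
    then show ?thesis using A by (simp add: balanced_def)
  qed
  ultimately have "balanced (insert (e, j) A)"
    using A e(1) unfolding balanced_def disjoint_family_on_def by (auto simp: Int_commute)
  then show ?thesis by blast
qed

end

text \<open>A maximal balanced family works: by \<open>extendable\<close>, an uncovered conflict
  edge would allow a larger one.\<close>

lemma conflicts_coverable: "\<exists>A. balanced A \<and> conflicts \<subseteq> \<Union> (cyc ` A)"
proof -
  have "finite (Collect balanced)"
    by (rule finite_subset[of _ "Pow (Sigma conflicts allowed)"])
      (use finite_choices in \<open>auto simp: balanced_def\<close>)
  moreover have "balanced {}"
    by (simp add: balanced_def disjoint_family_on_def)
  ultimately obtain A where A: "balanced A" "\<And>A'. balanced A' \<Longrightarrow> A \<subseteq> A' \<Longrightarrow> A' = A"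
    using finite_has_maximal[of "Collect balanced"] by blast
  have "e \<in> \<Union> (cyc ` A)" if e: "e \<in> conflicts" for e
  proof (rule ccontr)
    assume n: "e \<notin> \<Union> (cyc ` A)"
    then obtain j where "balanced (insert (e, j) A)"
      using extendable[OF A(1) e] by blast
    then have "(e, j) \<in> A" using A(2) by blast
    moreover have "e \<in> cyc (e, j)" by (simp add: cyc_def)
    ultimately show False using n by blast
  qed
  then show ?thesis using A(1) by blast
qed

text \<open>The coloring is \<open>\<rho> \<circ> swap A\<close>. Edges on chosen cycles are safe by
  \<open>allowed\<close>; all others keep their color and are not conflict edges.\<close>

lemma avoidable: "avoidable E d L"
proof -
  obtain A where A: "balanced A" and cover: "conflicts \<subseteq> \<Union> (cyc ` A)"
    using conflicts_coverable by blast
  have disj: "disjoint_family_on cyc A"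
    and choice: "\<And>e j. (e, j) \<in> A \<Longrightarrow> e \<in> E \<and> j \<in> allowed e"
    using A by (auto simp: balanced_def conflicts_def)
  have "proper_edge_coloring E d (swap A)"
    using choice by (intro swap_proper disj) (auto simp: allowed_def)
  then have "proper_edge_coloring E d (\<rho> \<circ> swap A)"
    using rho_range rho_inj[of UNIV]
    unfolding proper_edge_coloring_def properly_colored_def by (simp add: inj_eq)
  moreover have "(\<rho> \<circ> swap A) g \<notin> L g" if g: "g \<in> E" for g
  proof (cases "\<exists>p\<in>A. g \<in> cyc p")
    case True
    then obtain e j where ej: "(e, j) \<in> A" "g \<in> cyc (e, j)" by auto
    have j: "j \<in> cycle_colors e" and eE: "e \<in> E"
      and al: "\<And>x. x \<in> e \<Longrightarrow> \<rho> (h e) \<notin> L {x, nb j x}" "\<rho> j \<notin> L e" "\<rho> j \<notin> L (nb j ` e)"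
      using choice[OF ej(1)] by (auto simp: allowed_def)
    have sw: "swap A g = (if h g = j then h e else j)"
      by (rule swap_in_cycle[OF disj ej])
    show ?thesis
      using ej(2)
    proof (cases rule: cyc_cases)
      case (3 x)
      then have "h g = j"
        using nb_color[of x j] cycle_colors_range[OF j] edge_subset[OF eE] by auto
      then show ?thesis using sw al(1) 3 by simp
    qed (use sw al j in \<open>auto simp: cycle_colors_def\<close>)
  next
    case False
    then have "g \<notin> conflicts" using cover by blast
    then show ?thesis
      using g swap_outside[of A g] False by (auto simp: conflicts_def)
  qed
  ultimately show ?thesis unfolding avoidable_def by blast
qed

end


section \<open>The union bound\<close>

text \<open>These are \<open>T_pos\<close>, \<open>dm_le\<close> and \<open>many_cycles\<close> for
  \<open>T = s div 16\<close> and \<open>q = s div 64\<close>. From \<open>4 * \<mu> < X\<close>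
  follows \<open>2048 * d * \<mu> \<le> s ^ 2\<close>, and \<open>s \<le> d\<close> gives
  \<open>512 * X \<le> s\<close>, so \<open>s > 2048\<close>. The largest term of the sum is
  \<open>8 * T\<close>, about \<open>s / 2\<close>.\<close>

lemma parameter_bounds:
  fixes s d :: nat and \<mu> X :: real
  assumes "0 < d" "s \<le> d" "1 \<le> \<mu>" "4 * \<mu> < X" "X = real s ^ 2 / (512 * real d)"
  shows "0 < s div 16"
    and "d * nat \<lfloor>\<mu>\<rfloor> \<le> (s div 16) * (s div 64)"
    and "7 * nat \<lfloor>\<mu>\<rfloor> + 5 * nat \<lceil>2 * X\<rceil> + 8 * (s div 16) + 5 * (s div 64) < s - 1"
proof -
  have dX: "512 * (real d * X) = real s ^ 2"
    using assms(1,5) by simp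
  have "real d * (4 * \<mu>) \<le> real d * X"
    using assms(4) by (intro mult_left_mono) auto
  then have dm: "2048 * (real d * \<mu>) \<le> real s ^ 2"
    using dX by simp
  have "real d * 1 \<le> real d * \<mu>"
    using assms(3) by (intro mult_left_mono) auto
  moreover have "0 < real d" using assms(1) by simp
  ultimately have "0 < real s ^ 2"
    using dm by linarith
  then have s0: "0 < real s" by simp
  have sX: "512 * X \<le> real s"
  proof -
    have "real s * (512 * X) \<le> real d * (512 * X)"
      using assms(2,3,4) by (intro mult_right_mono) auto
    also have "\<dots> = real s * real s"
      using dX by (simp add: power2_eq_square mult_ac)
    finally show ?thesis using s0 by simp
  qed
  have s2048: "2048 * \<mu> < real s" using sX assms(4) by linarith
  then have s': "2048 < real s" using assms(3) by linarith
  show "0 < s div 16" using s' by simp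
  have m: "real (nat \<lfloor>\<mu>\<rfloor>) \<le> \<mu>" using assms(3) by simp
  have k: "real (nat \<lceil>2 * X\<rceil>) \<le> 2 * X + 1"
    using assms(3,4) by linarith
  have t: "real s / 16 - 1 \<le> real (s div 16)" "real (s div 16) \<le> real s / 16"
    and q: "real s / 64 - 1 \<le> real (s div 64)" "real (s div 64) \<le> real s / 64"
    by linarith+
  have "real (d * nat \<lfloor>\<mu>\<rfloor>) \<le> real d * \<mu>"
    using m by (simp add: mult_left_mono)
  \<comment> \<open>The factors have product \<open>s ^ 2 / 2048\<close> and, as
    \<open>s > 2048\<close>, stay below \<open>s / 16 - 1\<close> and \<open>s / 64 - 1\<close>,
    which absorbs the rounding in \<open>div\<close>.\<close>
  also have "\<dots> \<le> (real s / 24) * (3 * real s / 256)"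
    using dm by (simp add: power2_eq_square)
  also have "\<dots> \<le> real (s div 16) * real (s div 64)"
    using t q s' by (intro mult_mono) linarith+
  finally show "d * nat \<lfloor>\<mu>\<rfloor> \<le> (s div 16) * (s div 64)"
    by (simp flip: of_nat_mult)
  have "7 * real (nat \<lfloor>\<mu>\<rfloor>) + 5 * real (nat \<lceil>2 * X\<rceil>) + 8 * real (s div 16) + 5 * real (s div 64)
      < real s - 1"
    using m k t q s' s2048 sX by linarith
  also have "\<dots> = real (s - 1)" using s' by simp
  finally show "7 * nat \<lfloor>\<mu>\<rfloor> + 5 * nat \<lceil>2 * X\<rceil> + 8 * (s div 16) + 5 * (s div 64) < s - 1"
    by linarith
qed

theorem corollary1p5:
  fixes V :: "'v set" and E :: "'v set set" and d s n :: nat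
    and h :: "'v set \<Rightarrow> nat" and L :: "'v set \<Rightarrow> nat set" and c :: real
  assumes "ds_edge_colorable V E d s"
    and "card V = n"
    and "standard_coloring E d s h"
    and "s \<ge> 11"
    and "1 / 2 * (2 powr (- 11) * real s powr (2 - c) * inverse (real d))
           powr (2 powr (- 9) * inverse (real d) * real s ^ 2) \<ge> real n"
    and "list_assignment E d L"
    and "sparse V E d s h (real s powr (c - 1)) L"
  shows "avoidable E d L"
proof -
  have proper: "proper_edge_coloring E d h"
    using assms(3) by (simp add: standard_coloring_def)
  interpret colored_graph V E d h
    using assms(1) proper by unfold_locales (simp_all add: ds_edge_colorable_def)
  define \<mu> where "\<mu> = real s powr c"
  define X where "X = real s ^ 2 / (512 * real d)"
  have \<mu>: "real s powr (c - 1) * real s = \<mu>"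
    using assms(4) by (simp add: \<mu>_def powr_diff)
  have card_L: "real (card (L e)) \<le> \<mu>" and finite_L: "finite (L e)" if "e \<in> E" for e
    using assms(6,7) that finite_subset[of "L e" "{1..d}"] unfolding \<mu>[symmetric]
    by (simp_all add: sparse_def list_assignment_def)
  show ?thesis
  proof (cases "E = {} \<or> \<mu> < 1")
    case True
    have "L e = {}" if "e \<in> E" for e
    proof -
      have "card (L e) = 0" using True card_L[OF that] that by auto
      then show ?thesis using finite_L[OF that] by simp
    qed
    then show ?thesis using proper by (auto simp: avoidable_def)
  next
    case False
    then obtain e0 where e0: "e0 \<in> E" and \<mu>1: "1 \<le> \<mu>" by auto
    have n2: "2 \<le> n"
      using card_mono[OF finite_V edge_subset[OF e0]] edge_card[OF e0] assms(2) by simp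
    have d: "0 < d" using color_range[OF e0] by simp
    \<comment> \<open>The color of \<open>e0\<close> is not a second color, so \<open>s - 1\<close>
      is at most \<open>d - 1\<close>.\<close>
    have "card (cycle_colors e0) \<le> card ({1..d} - {h e0})"
      by (rule card_mono[OF _ cycle_colors_subset]) simp
    then have sd: "s \<le> d"
      using card_cycle_colors[OF assms(3) e0] color_range[OF e0] assms(4) d by simp
    \<comment> \<open>\<open>B\<close> and \<open>X\<close> are the base and the exponent of the
      power in the hypothesis on \<open>n\<close>.\<close>
    define B where "B = X / (4 * \<mu>)"
    have B: "B = 2 powr (- 11) * real s powr (2 - c) * inverse (real d)"
      using assms(4) d by (simp add: B_def X_def \<mu>_def powr_diff powr_minus field_simps)
    have X: "X = 2 powr (- 9) * inverse (real d) * real s ^ 2"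
      by (simp add: X_def powr_minus field_simps)
    have BX: "2 * real n \<le> B powr X"
      using assms(5) unfolding B X by simp
    have X0: "0 < X" using assms(4) d by (simp add: X_def)
    have "0 < B" using X0 \<mu>1 by (simp add: B_def)
    \<comment> \<open>A base of at most 1 would make the power at most 1, but it is at least
      \<open>2 * n\<close>.\<close>
    have B1: "1 < B"
    proof (rule ccontr)
      assume "\<not> 1 < B"
      then have "B powr X \<le> 1 powr X"
        using X0 \<open>0 < B\<close> by (intro powr_mono2) auto
      then show False using BX n2 by simp
    qed
    then have X\<mu>: "4 * \<mu> < X"
      using \<mu>1 by (simp add: B_def field_simps)
    define m where "m = nat \<lfloor>\<mu>\<rfloor>"
    define \<kappa> where "\<kappa> = nat \<lceil>2 * X\<rceil>"
    note bounds = parameter_bounds[OF d sd \<mu>1 X\<mu> X_def, folded m_def \<kappa>_def]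
    have le_m: "k \<le> m" if "real k \<le> \<mu>" for k
      using that by (simp add: m_def le_nat_floor)
    have m: "0 < m" "real m \<le> \<mu>" using \<mu>1 by (simp_all add: m_def)
    have \<kappa>: "2 * X \<le> real \<kappa>" by (simp add: \<kappa>_def real_nat_ceiling_ge)

    \<comment> \<open>As \<open>\<kappa> \<ge> 2 * X\<close>, the power \<open>B ^ \<kappa>\<close>
      dominates the square of the hypothesis, enough for order \<open>n ^ 2\<close> many events.
      Moreover \<open>B * \<mu> = X / 4\<close> is below \<open>\<kappa> / 3\<close>.\<close>
    have "4 * real n ^ 2 \<le> (B powr X) ^ 2"
      using power_mono[OF BX, of 2] by (simp add: power_mult_distrib)
    also have "\<dots> = B powr (2 * X)"
      using \<open>0 < B\<close> by (simp add: powr_powr mult.commute flip: powr_numeral)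
    also have "\<dots> \<le> B ^ \<kappa>"
      using \<kappa> B1 by (simp add: powr_mono flip: powr_realpow)
    finally have "4 * real n ^ 2 * real m ^ \<kappa> \<le> B ^ \<kappa> * \<mu> ^ \<kappa>"
      using m \<open>0 < B\<close> by (intro mult_mono power_mono) auto
    also have "\<dots> = (X / 4) ^ \<kappa>"
      using \<mu>1 by (simp add: B_def flip: power_mult_distrib)
    also have "\<dots> \<le> (real \<kappa> / 3) ^ \<kappa>"
      using \<kappa> X0 by (intro power_mono) auto
    also have "\<dots> \<le> fact \<kappa>" by (rule power_self_le_fact)
    finally have "real (4 * n ^ 2 * m ^ \<kappa>) \<le> real (fact \<kappa>)" by simp
    then have "4 * n ^ 2 * m ^ \<kappa> \<le> fact \<kappa>" by (simp only: of_nat_le_iff)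
    moreover have "0 < n ^ 2 * m ^ \<kappa>" using n2 m by simp
    ultimately have fact: "2 * n ^ 2 * m ^ \<kappa> < fact \<kappa>" by linarith

    \<comment> \<open>The events of the union bound: for a vertex, the hits are the colors of its
      conflict edges; for an edge, the second colors whose new color is forbidden on the opposite
      edge. Colors giving no cycle get the empty set and never count.\<close>
    define F :: "'v + 'v set \<Rightarrow> nat \<Rightarrow> nat set" where
      "F i j = (case i of Inl x \<Rightarrow> L {x, nb j x}
         | Inr e \<Rightarrow> if j \<in> cycle_colors e then L (nb j ` e) else {})" for i j
    have F: "finite (F i j) \<and> card (F i j) \<le> m" if "i \<in> V <+> E" "j \<in> {1..d}" for i j
    proof -
      have "F i j = {} \<or> (\<exists>e\<in>E. F i j = L e)"
        using that nb_edge by (auto simp: F_def cycle_colors_def split: if_splits)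
      then show ?thesis using finite_L card_L le_m by auto
    qed
    \<comment> \<open>The crude bound \<open>n ^ 2\<close> on the number of edges suffices.\<close>
    have "E \<subseteq> (\<lambda>(x, y). {x, y}) ` (V \<times> V)"
    proof
      fix e assume e: "e \<in> E"
      then obtain x y where "e = {x, y}"
        using edge_card[OF e] unfolding card_2_iff by blast
      then show "e \<in> (\<lambda>(x, y). {x, y}) ` (V \<times> V)"
        using edge_subset[OF e] by auto
    qed
    then have "card E \<le> card (V \<times> V)"
      using finite_V by (intro surj_card_le) auto
    then have "card (V <+> E) \<le> n + n * n"
      using finite_V finite_E assms(2) by (simp add: card_Plus card_cartesian_product)
    also have "\<dots> \<le> 2 * n ^ 2" using n2 by (simp add: power2_eq_square)
    finally have "card (V <+> E) * m ^ \<kappa> \<le> 2 * n ^ 2 * m ^ \<kappa>"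
      by (rule mult_right_mono) simp
    then have "card (V <+> E) * m ^ \<kappa> < fact \<kappa>" using fact by linarith
    then obtain \<rho> where \<rho>: "\<rho> permutes {1..d}"
      and hits: "\<And>i. i \<in> V <+> E \<Longrightarrow> card {j \<in> {1..d}. \<rho> j \<in> F i j} < \<kappa>"
      using exists_permutation_few_hits[of "{1..d}" "V <+> E" F m \<kappa>] F finite_V finite_E
      by (auto simp: finite_Plus)

    have "sparse_conflicts V E d h L \<rho> m \<kappa> (s div 16) (s div 64)"
    proof unfold_locales
      show "card {e \<in> E. x \<in> e \<and> \<rho> (h e) \<in> L e} \<le> \<kappa>" if x: "x \<in> V" for x
      proof -
        have "card {e \<in> E. x \<in> e \<and> \<rho> (h e) \<in> L e} \<le> card {j \<in> {1..d}. \<rho> j \<in> F (Inl x) j}"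
        proof (rule card_inj_on_le[of h])
          show "inj_on h {e \<in> E. x \<in> e \<and> \<rho> (h e) \<in> L e}"
            using same_color_eq[of _ _ x] by (intro inj_onI) simp
          show "h ` {e \<in> E. x \<in> e \<and> \<rho> (h e) \<in> L e} \<subseteq> {j \<in> {1..d}. \<rho> j \<in> F (Inl x) j}"
          proof (rule image_subsetI)
            fix e assume e: "e \<in> {e \<in> E. x \<in> e \<and> \<rho> (h e) \<in> L e}"
            then have "{x, nb (h e) x} = e" using edge_eq[of e x] by simp
            then show "h e \<in> {j \<in> {1..d}. \<rho> j \<in> F (Inl x) j}"
              using e color_range[of e] by (simp add: F_def)
          qed
        qed simp
        then show ?thesis using hits[OF InlI[OF x]] by linarith
      qed
      show "card {j \<in> cycle_colors e. \<rho> j \<in> L (nb j ` e)} \<le> \<kappa>" if e: "e \<in> E" for e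
      proof -
        have "{j \<in> cycle_colors e. \<rho> j \<in> L (nb j ` e)} \<subseteq> {j \<in> {1..d}. \<rho> j \<in> F (Inr e) j}"
          using cycle_colors_range by (auto simp: F_def)
        then have "card {j \<in> cycle_colors e. \<rho> j \<in> L (nb j ` e)} \<le> card {j \<in> {1..d}. \<rho> j \<in> F (Inr e) j}"
          by (intro card_mono) auto
        then show ?thesis using hits[OF InrI[OF e]] by linarith
      qed
      show "card {e \<in> E. x \<in> e \<and> a \<in> L e} \<le> m" if "x \<in> V" "a \<in> {1..d}" for x a
        using assms(7) that unfolding sparse_def \<mu> by (intro le_m) blast
      show "card {e \<in> E. h e = i \<and> e \<in> near 6 x \<and> a \<in> L e} \<le> m"
        if "x \<in> V" "i \<in> {1..d}" "a \<in> {1..d}" for x i a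
      proof -
        \<comment> \<open>Any edge at \<open>x\<close> could serve as center of the 6-neighborhood;
          regularity provides this one.\<close>
        let ?f = "{x, nb i x}" and ?M = "{e \<in> E. h e = i}"
        have f: "?f \<in> E" by (rule nb_edge[OF that(1,2)])
        have "standard_matching E d h ?M"
          unfolding standard_matching_def using that(2) by blast
        then have "real (card {e \<in> ?M \<inter> neighborhood V E 6 ?f. a \<in> L e}) \<le> \<mu>"
          using assms(7) f that(3) unfolding sparse_def \<mu> by blast
        then have "card {e \<in> ?M \<inter> neighborhood V E 6 ?f. a \<in> L e} \<le> m" by (rule le_m)
        moreover have "card {e \<in> E. h e = i \<and> e \<in> near 6 x \<and> a \<in> L e}
            \<le> card {e \<in> ?M \<inter> neighborhood V E 6 ?f. a \<in> L e}"
          using near_subset_neighborhood[OF f, of x 6] finite_E by (intro card_mono) auto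
        ultimately show ?thesis by linarith
      qed
      show "7 * m + 5 * \<kappa> + 8 * (s div 16) + 5 * (s div 64) < card (cycle_colors e)" if "e \<in> E" for e
        using bounds(3) card_cycle_colors[OF assms(3) that] by linarith
    qed (use \<rho> finite_L card_L le_m bounds in auto)
    then show ?thesis by (rule sparse_conflicts.avoidable)
  qed
qed

end
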